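(* Let $G=(V,E,\omega,m)$ be a finite connected weighted graph, $n$ a positive integer, $f_1,\dots,f_n:V\to\mathbb{R}$, $c\in\mathbb{R}$, and let $u:V\to\mathbb{R}$ be a solution of $$-\Delta u(x)=\sum_{i=1}^n f_i(x)e^{iu(x)}+c,\qquad x\in V.$$ Let $K>0$ be a constant such that $$\sum_{i=1}^n\max_{x\in V}|f_i(x)|+|c|\leqslant K,$$ and such that either $|c|\geqslant K^{-1}$, or $c=0$ and $|\overline{f_1}|\geqslant K^{-1}$. Suppose that there exists a vertex $x_0\in V$ such that one of the following conditions holds: (i) $D_{F_n}(x_0)\geqslant \frac1K$; (ii) $D_{F_n}(x_0)\leqslant-\frac1K$, and moreover for every $x\in V$ either $f_i(x)\leqslant 0$ for every $1\leqslant i\leqslant n$, or $D_{F_n}(x)\leqslant-\frac1K$. Then there exists a constant $C_n$, depending only on $K$, $n$ and the weighted graph $G$, such that $$\max_{x\in V}|u(x)|\leqslant C_n.$$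
   Context: A finite connected weighted graph $G=(V,E,\omega,m)$ consists of a finite connected graph $(V,E)$, a positive vertex weight $m:V\to(0,\infty)$, and a symmetric edge weight $\omega:V\times V\to[0,\infty)$, $\omega_{xy}=\omega_{yx}$, with $\omega_{xy}>0$ if and only if $\{x,y\}\in E$ (written $x\sim y$). The graph Laplacian is $\Delta u(x)=\frac{1}{m(x)}\sum_{y\sim x}\omega_{xy}(u(y)-u(x))$. The average of $f:V\to\mathbb{R}$ is $\overline f=\frac{\sum_{x\in V}m(x)f(x)}{\sum_{x\in V}m(x)}$. Put $F_n(x,y)=\sum_{i=1}^n f_i(x)e^{iy}+c$ for $x\in V$, $y\in\mathbb{R}$. The leading coefficient $D_{F_n}(x)$ is $f_k(x)$, where $k$ is the largest index in $\{1,\dots,n\}$ with $f_k(x)\neq0$, and $D_{F_n}(x)=0$ if $f_1(x)=\dots=f_n(x)=0$. *)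

theory Defs
  imports Complex_Main "Graph_Theory.Digraph_Component"
begin

text \<open>
  An undirected simple graph is a loop-free, symmetric \<^typ>\<open>'v pair_pre_digraph\<close>
  (locale \<^locale>\<open>pair_graph\<close>, which includes finiteness): the edge \<open>{x, y}\<close> is
  represented by the two arcs \<open>(x, y)\<close> and \<open>(y, x)\<close>.
  Functions on the vertex set are total functions on the vertex type; their values
  outside \<open>pverts G\<close> are irrelevant.
\<close>

locale weighted_graph = pair_graph G
  for G :: "'v pair_pre_digraph" +
  fixes \<omega> :: "'v \<Rightarrow> 'v \<Rightarrow> real" and m :: "'v \<Rightarrow> real"
  assumes graph_connected: "Digraph_Component.connected (with_proj G)"
    and vertex_weight_pos: "x \<in> pverts G \<Longrightarrow> m x > 0"
    and edge_weight_nonneg: "x \<in> pverts G \<Longrightarrow> y \<in> pverts G \<Longrightarrow> \<omega> x y \<ge> 0"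
    and edge_weight_sym: "x \<in> pverts G \<Longrightarrow> y \<in> pverts G \<Longrightarrow> \<omega> x y = \<omega> y x"
    and edge_weight_pos_iff:
      "x \<in> pverts G \<Longrightarrow> y \<in> pverts G \<Longrightarrow> \<omega> x y > 0 \<longleftrightarrow> (x, y) \<in> parcs G"

definition graph_laplacian ::
  "'v pair_pre_digraph \<Rightarrow> ('v \<Rightarrow> 'v \<Rightarrow> real) \<Rightarrow> ('v \<Rightarrow> real) \<Rightarrow> ('v \<Rightarrow> real) \<Rightarrow> 'v \<Rightarrow> real"
where
  "graph_laplacian G \<omega> m u x =
     (1 / m x) * (\<Sum>y\<in>{y \<in> pverts G. (x, y) \<in> parcs G}. \<omega> x y * (u y - u x))"

definition graph_average ::
  "'v pair_pre_digraph \<Rightarrow> ('v \<Rightarrow> real) \<Rightarrow> ('v \<Rightarrow> real) \<Rightarrow> real"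
where
  "graph_average G m f = (\<Sum>x\<in>pverts G. m x * f x) / (\<Sum>x\<in>pverts G. m x)"

definition exp_poly :: "nat \<Rightarrow> (nat \<Rightarrow> 'v \<Rightarrow> real) \<Rightarrow> real \<Rightarrow> 'v \<Rightarrow> real \<Rightarrow> real" where
  "exp_poly n f c x y = (\<Sum>i=1..n. f i x * exp (real i * y)) + c"

text \<open>The constant term \<open>c\<close> never counts as leading coefficient.\<close>

definition exp_lead_coeff :: "nat \<Rightarrow> (nat \<Rightarrow> 'v \<Rightarrow> real) \<Rightarrow> 'v \<Rightarrow> real" where
  "exp_lead_coeff n f x =
     (if \<forall>i\<in>{1..n}. f i x = 0 then 0 else f (Max {i \<in> {1..n}. f i x \<noteq> 0}) x)"

end

(*
  At a vertex where u exceeds min u by s, the equation bounds the Laplacian of u above by a function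
  of s, as long as min u itself is bounded above. Propagating this along paths from a minimum vertex
  bounds the oscillation of u, hence max u. If min u is very large, the exponential leading terms are
  in control: in case (i) the value of the nonlinearity at x0 exceeds anything the Laplacian can
  produce from u >= 0, and in case (ii) the weighted sum of the nonlinearity is negative, although
  it must vanish. For the lower bound let M = max u be very negative. The nonlinearity is then close
  to c, or, if c = 0, to f_1 e^M up to O(e^(2M)), because the oscillation is O(e^M); its vanishing
  average contradicts the lower bound on |c| or on the average of f_1.
*)

theory Submission
  imports Defs
begin

section \<open>Pointwise estimates for the exponential nonlinearity\<close>

lemma sum_bound_of_Max_bound:
  fixes f :: "nat \<Rightarrow> 'v \<Rightarrow> real"
  assumes "finite V" "x \<in> V"
    and "(\<Sum>i=1..n. Max ((\<lambda>x. \<bar>f i x\<bar>) ` V)) + \<bar>c\<bar> \<le> K"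
  shows "(\<Sum>i=1..n. \<bar>f i x\<bar>) + \<bar>c\<bar> \<le> K"
proof -
  have "(\<Sum>i=1..n. \<bar>f i x\<bar>) \<le> (\<Sum>i=1..n. Max ((\<lambda>x. \<bar>f i x\<bar>) ` V))"
    using assms by (intro sum_mono Max_ge) auto
  then show ?thesis using assms(3) by linarith
qed

text \<open>Crude growth bound, used to control the Laplacian from above; \<open>1 \<le> b\<close>
  lets the constant term be absorbed into the same factor.\<close>

lemma abs_exp_poly_le:
  assumes "\<And>i. 1 \<le> i \<Longrightarrow> i \<le> n \<Longrightarrow> exp (real i * y) \<le> b" and "1 \<le> b"
    and "(\<Sum>i=1..n. \<bar>f i x\<bar>) + \<bar>c\<bar> \<le> K"
  shows "\<bar>exp_poly n f c x y\<bar> \<le> K * b"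
proof -
  have "\<bar>exp_poly n f c x y\<bar> \<le> (\<Sum>i=1..n. \<bar>f i x * exp (real i * y)\<bar>) + \<bar>c\<bar>"
    unfolding exp_poly_def by (rule order_trans[OF abs_triangle_ineq add_right_mono[OF sum_abs]])
  also have "\<dots> \<le> (\<Sum>i=1..n. \<bar>f i x\<bar> * b) + \<bar>c\<bar> * b"
    using assms(1) mult_left_mono[OF assms(2), of "\<bar>c\<bar>"]
    by (intro add_mono sum_mono) (auto simp: abs_mult mult_left_mono)
  also have "\<dots> = ((\<Sum>i=1..n. \<bar>f i x\<bar>) + \<bar>c\<bar>) * b"
    by (simp add: sum_distrib_right distrib_right)
  also have "\<dots> \<le> K * b" using assms by (intro mult_right_mono) auto
  finally show ?thesis .
qed

text \<open>For nonpositive arguments all exponentials with index at least 1 are at most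
  \<open>exp M\<close>, so the nonlinearity is \<open>c\<close> up to first order in
  \<open>exp M\<close>.\<close>

lemma exp_poly_minus_const_le:
  assumes "y \<le> M" "M \<le> 0" and "(\<Sum>i=1..n. \<bar>f i x\<bar>) + \<bar>c\<bar> \<le> K"
  shows "\<bar>exp_poly n f c x y - c\<bar> \<le> K * exp M"
proof -
  have "\<bar>exp_poly n f c x y - c\<bar> \<le> (\<Sum>i=1..n. \<bar>f i x * exp (real i * y)\<bar>)"
    unfolding exp_poly_def by simp
  also have "\<dots> \<le> (\<Sum>i=1..n. \<bar>f i x\<bar> * exp M)"
  proof (intro sum_mono)
    fix i assume i: "i \<in> {1..n}"
    have "real i * y \<le> 1 * y" using assms i by (intro mult_right_mono_neg) auto
    then have "exp (real i * y) \<le> exp M" using assms by simp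
    then show "\<bar>f i x * exp (real i * y)\<bar> \<le> \<bar>f i x\<bar> * exp M"
      by (simp add: abs_mult mult_left_mono)
  qed
  also have "\<dots> = (\<Sum>i=1..n. \<bar>f i x\<bar>) * exp M" by (simp add: sum_distrib_right)
  also have "\<dots> \<le> K * exp M" using assms by (intro mult_right_mono) auto
  finally show ?thesis .
qed

text \<open>Indices from 2 on contribute at most \<open>exp (2 * M)\<close>. This second-order
  remainder is what makes the linear term visible when \<open>c = 0\<close>.\<close>

lemma exp_poly_minus_linear_le:
  assumes "y \<le> M" "M \<le> 0" and "(\<Sum>i=1..n. \<bar>f i x\<bar>) \<le> K" and "1 \<le> n"
  shows "\<bar>exp_poly n f 0 x y - f 1 x * exp y\<bar> \<le> K * (exp M)\<^sup>2"
proof -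
  have "exp_poly n f 0 x y - f 1 x * exp y = (\<Sum>i\<in>{1..n} - {1}. f i x * exp (real i * y))"
    unfolding exp_poly_def using assms(4) by (subst sum.remove[of _ 1]) auto
  then have "\<bar>exp_poly n f 0 x y - f 1 x * exp y\<bar>
      \<le> (\<Sum>i\<in>{1..n} - {1}. \<bar>f i x * exp (real i * y)\<bar>)"
    by simp
  also have "\<dots> \<le> (\<Sum>i\<in>{1..n} - {1}. \<bar>f i x\<bar> * (exp M)\<^sup>2)"
  proof (intro sum_mono)
    fix i assume i: "i \<in> {1..n} - {1}"
    have "real i * y \<le> 2 * y" using assms i by (intro mult_right_mono_neg) auto
    then have "exp (real i * y) \<le> exp (2 * M)" using assms by simp
    also have "\<dots> = (exp M)\<^sup>2" by (simp add: exp_double)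
    finally show "\<bar>f i x * exp (real i * y)\<bar> \<le> \<bar>f i x\<bar> * (exp M)\<^sup>2"
      by (simp add: abs_mult mult_left_mono)
  qed
  also have "\<dots> \<le> (\<Sum>i=1..n. \<bar>f i x\<bar> * (exp M)\<^sup>2)" by (intro sum_mono2) auto
  also have "\<dots> = (\<Sum>i=1..n. \<bar>f i x\<bar>) * (exp M)\<^sup>2" by (simp add: sum_distrib_right)
  also have "\<dots> \<le> K * (exp M)\<^sup>2" using assms by (intro mult_right_mono) auto
  finally show ?thesis .
qed

section \<open>Dominance of the leading term, and of the exponential over linear growth\<close>

lemma exp_lead_coeff_uminus:
  "exp_lead_coeff n (\<lambda>i x. - f i x) x = - exp_lead_coeff n f x"
  by (simp add: exp_lead_coeff_def)

lemma exp_poly_uminus: "exp_poly n (\<lambda>i x. - f i x) (- c) x y = - exp_poly n f c x y"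
  by (simp add: exp_poly_def sum_negf)

text \<open>If \<open>k\<close> is the leading index, all lower terms together with \<open>c\<close>
  cost at most \<open>K * e\<close> with \<open>e = exp ((k - 1) * y)\<close>, while the leading
  term gives at least \<open>e * exp y / K\<close>. Dropping the common factor
  \<open>e \<ge> 1\<close> leaves a bound that does not depend on \<open>k\<close>.\<close>

lemma exp_poly_ge_of_lead_coeff:
  assumes K: "K > 0" and lead: "exp_lead_coeff n f x \<ge> 1 / K"
    and bd: "(\<Sum>i=1..n. \<bar>f i x\<bar>) + \<bar>c\<bar> \<le> K"
    and y: "0 \<le> y" "K * K \<le> exp y"
  shows "exp y / K - K \<le> exp_poly n f c x y"
proof -
  define I where "I = {i \<in> {1..n}. f i x \<noteq> 0}"
  define k where "k = Max I"
  define e where "e = exp (real (k - 1) * y)"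
  \<comment> \<open>This excludes the default value 0 of the leading coefficient, so the index set
    is nonempty and \<open>Max I\<close> is meaningful.\<close>
  have nz: "exp_lead_coeff n f x \<noteq> 0"
    using K lead by (metis divide_pos_pos leD zero_less_one)
  then have "I \<noteq> {}" unfolding exp_lead_coeff_def I_def by (auto split: if_splits)
  moreover have finI: "finite I" by (simp add: I_def)
  ultimately have "k \<in> I" unfolding k_def by (rule Max_in[rotated])
  then have k: "1 \<le> k" "k \<le> n" by (auto simp: I_def)
  have fk: "1 / K \<le> f k x"
    using lead nz unfolding exp_lead_coeff_def k_def I_def by (auto split: if_splits)
  have le: "i < k" if "i \<in> {1..n} - {k}" "f i x \<noteq> 0" for i
    proof -
    have "i \<in> I" using that by (simp add: I_def)
    then have "i \<le> k" unfolding k_def using finI by (rule Max_ge[rotated])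
    then show ?thesis using that by auto
  qed
  have e1: "1 \<le> e" using y by (simp add: e_def)
  have ek: "exp (real k * y) = e * exp y"
    using k by (simp add: e_def algebra_simps flip: exp_add)
  have "- ((\<Sum>i\<in>{1..n} - {k}. \<bar>f i x\<bar>) * e) = (\<Sum>i\<in>{1..n} - {k}. - (\<bar>f i x\<bar> * e))"
    by (simp add: sum_distrib_right sum_negf)
  also have "\<dots> \<le> (\<Sum>i\<in>{1..n} - {k}. f i x * exp (real i * y))"
  proof (intro sum_mono)
    fix i assume i: "i \<in> {1..n} - {k}"
    show "- (\<bar>f i x\<bar> * e) \<le> f i x * exp (real i * y)"
    proof (cases "f i x = 0")
      case False
      then have "real i \<le> real (k - 1)" using le[OF i] by simp
      then have "exp (real i * y) \<le> e" using y by (simp add: e_def mult_right_mono)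
      then have "\<bar>f i x * exp (real i * y)\<bar> \<le> \<bar>f i x\<bar> * e"
        by (simp add: abs_mult mult_left_mono)
      then show ?thesis by linarith
    qed simp
  qed
  finally have low: "- ((\<Sum>i\<in>{1..n} - {k}. \<bar>f i x\<bar>) * e)
      \<le> (\<Sum>i\<in>{1..n} - {k}. f i x * exp (real i * y))" .
  have "(\<Sum>i\<in>{1..n} - {k}. \<bar>f i x\<bar>) + \<bar>c\<bar> \<le> K"
  proof -
    have "(\<Sum>i\<in>{1..n} - {k}. \<bar>f i x\<bar>) \<le> (\<Sum>i=1..n. \<bar>f i x\<bar>)" by (intro sum_mono2) auto
    then show ?thesis using bd by linarith
  qed
  then have "((\<Sum>i\<in>{1..n} - {k}. \<bar>f i x\<bar>) + \<bar>c\<bar>) * e \<le> K * e"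
    using e1 by (intro mult_right_mono) auto
  moreover have "\<bar>c\<bar> * 1 \<le> \<bar>c\<bar> * e" using e1 by (intro mult_left_mono) auto
  moreover have "1 / K * (e * exp y) \<le> f k x * (e * exp y)"
    using fk e1 by (intro mult_right_mono) auto
  moreover have "exp_poly n f c x y
      = f k x * (e * exp y) + (\<Sum>i\<in>{1..n} - {k}. f i x * exp (real i * y)) + c"
    unfolding exp_poly_def using k ek by (subst sum.remove[of _ k]) auto
  ultimately have "1 / K * (e * exp y) - K * e \<le> exp_poly n f c x y"
    using low by (simp add: distrib_right)
  \<comment> \<open>The hypothesis \<open>K * K \<le> exp y\<close> enters here: the bracket is
    nonnegative, so the factor \<open>e\<close> may be lowered to 1.\<close>
  moreover have "0 \<le> exp y / K - K" using y K by (simp add: field_simps)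
  then have "1 * (exp y / K - K) \<le> e * (exp y / K - K)"
    using e1 by (intro mult_right_mono)
  ultimately show ?thesis by (simp add: algebra_simps)
qed

lemma exp_poly_le_of_lead_coeff:
  assumes "K > 0" and "exp_lead_coeff n f x \<le> - (1 / K)"
    and "(\<Sum>i=1..n. \<bar>f i x\<bar>) + \<bar>c\<bar> \<le> K" and "0 \<le> y" "K * K \<le> exp y"
  shows "exp_poly n f c x y \<le> K - exp y / K"
  using exp_poly_ge_of_lead_coeff[of K n "\<lambda>i x. - f i x" x "- c" y] assms
  by (simp add: exp_lead_coeff_uminus exp_poly_uminus)

lemma exp_dominates_linear:
  fixes a b :: real
  assumes "0 \<le> a" "0 \<le> b"
  obtains B where "0 \<le> B" "\<And>t. B \<le> t \<Longrightarrow> a * t + b < exp t"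
proof
  \<comment> \<open>Beyond this threshold \<open>t \<ge> 1\<close> and
    \<open>a + b \<le> t / 4\<close>, so the linear function is at most \<open>t * t / 4\<close>,
    which \<open>(1 + t / 2)\<close> squared exceeds.\<close>
  show "0 \<le> 4 * (a + b) + 1" using assms by simp
  fix t :: real assume t: "4 * (a + b) + 1 \<le> t"
  have "0 \<le> 4 * (a + b)" using assms by simp
  then have "1 \<le> t" using t by linarith
  have "a * t + b \<le> (a + b) * t"
    using \<open>1 \<le> t\<close> assms mult_left_mono[of 1 t b] by (simp add: distrib_right)
  also have "\<dots> \<le> t / 4 * t" using \<open>1 \<le> t\<close> t by (intro mult_right_mono) auto
  also have "\<dots> < (1 + t / 2)\<^sup>2" using \<open>1 \<le> t\<close> by (simp add: power2_eq_square algebra_simps)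
  also have "\<dots> \<le> (exp (t / 2))\<^sup>2" using \<open>1 \<le> t\<close> by (intro power_mono) auto
  also have "\<dots> = exp t" by (simp flip: exp_double)
  finally show "a * t + b < exp t" .
qed

section \<open>Laplacian and averages on the graph\<close>

context weighted_graph
begin

abbreviation "nbrs x \<equiv> {y \<in> pverts G. (x, y) \<in> parcs G}"

lemma verts_nonempty: "pverts G \<noteq> {}"
  using graph_connected by (simp add: connected_conv)

lemma laplacian_mult_weight:
  "x \<in> pverts G \<Longrightarrow>
    m x * graph_laplacian G \<omega> m u x = (\<Sum>y\<in>nbrs x. \<omega> x y * (u y - u x))"
  using vertex_weight_pos[of x] by (simp add: graph_laplacian_def)

lemma laplacian_cmult:
  "graph_laplacian G \<omega> m (\<lambda>x. k * u x) x = k * graph_laplacian G \<omega> m u x"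
  by (simp add: graph_laplacian_def sum_distrib_left algebra_simps)

text \<open>The flow \<open>\<omega> x y * (u y - u x)\<close> is antisymmetric, so its double sum
  equals its own negative.\<close>

lemma sum_laplacian_eq_0: "(\<Sum>x\<in>pverts G. m x * graph_laplacian G \<omega> m u x) = 0"
proof -
  \<comment> \<open>Extension by zero to all pairs makes both summation ranges independent, so that
    the sums can be swapped.\<close>
  define g where "g x y = (if (x, y) \<in> parcs G then \<omega> x y * (u y - u x) else 0)" for x y
  have "(\<Sum>x\<in>pverts G. m x * graph_laplacian G \<omega> m u x)
      = (\<Sum>x\<in>pverts G. \<Sum>y\<in>pverts G. g x y)"
    using pair_finite_verts
    by (intro sum.cong refl) (auto simp: laplacian_mult_weight g_def sum.inter_filter)
  moreover have "(\<Sum>x\<in>pverts G. \<Sum>y\<in>pverts G. g x y) = - (\<Sum>x\<in>pverts G. \<Sum>y\<in>pverts G. g x y)"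
  proof -
    have "(\<Sum>x\<in>pverts G. \<Sum>y\<in>pverts G. g x y) = (\<Sum>y\<in>pverts G. \<Sum>x\<in>pverts G. g x y)"
      by (rule sum.swap)
    also have "\<dots> = (\<Sum>y\<in>pverts G. \<Sum>x\<in>pverts G. - g y x)"
      using edge_weight_sym by (intro sum.cong refl) (auto simp: g_def algebra_simps dest: arcs_symmetric)
    finally show ?thesis by (simp add: sum_negf)
  qed
  ultimately show ?thesis by simp
qed

lemma weight_sum_pos: "0 < (\<Sum>x\<in>pverts G. m x)"
  using pair_finite_verts verts_nonempty vertex_weight_pos by (intro sum_pos) auto

text \<open>The average of \<open>g\<close> vanishes, so the average of \<open>h\<close> is that of
  \<open>h - g\<close>. Applied with \<open>g\<close> the nonlinearity and \<open>h\<close> a simple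
  approximation of it.\<close>

lemma abs_average_le_of_close:
  assumes "(\<Sum>x\<in>pverts G. m x * g x) = 0"
    and "\<And>x. x \<in> pverts G \<Longrightarrow> \<bar>g x - h x\<bar> \<le> b"
  shows "\<bar>graph_average G m h\<bar> \<le> b"
proof -
  have "\<bar>\<Sum>x\<in>pverts G. m x * h x\<bar> = \<bar>\<Sum>x\<in>pverts G. m x * (g x - h x)\<bar>"
    using assms(1) by (simp add: right_diff_distrib sum_subtractf)
  also have "\<dots> \<le> (\<Sum>x\<in>pverts G. \<bar>m x * (g x - h x)\<bar>)" by (rule sum_abs)
  also have "\<dots> \<le> (\<Sum>x\<in>pverts G. m x * b)"
    using assms(2) vertex_weight_pos
    by (intro sum_mono) (auto simp: abs_mult less_imp_le intro!: mult_mono)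
  also have "\<dots> = b * (\<Sum>x\<in>pverts G. m x)" by (simp add: sum_distrib_left mult.commute)
  finally show ?thesis
    using weight_sum_pos by (simp add: graph_average_def pos_divide_le_eq)
qed

section \<open>Oscillation bounds from an upper bound on the Laplacian\<close>

text \<open>
  At the end of an arc \<open>(x, y)\<close> the excess over the minimum is at most
  \<open>m x * graph_laplacian u x\<close> plus the degree times the excess at \<open>x\<close>, divided by \<open>\<omega> x y\<close>.
  A bound therefore propagates along paths from the minimum.
\<close>

lemma bound_along_path:
  assumes "mono h" and "z \<rightarrow>\<^sup>*\<^bsub>with_proj G\<^esub> x"
  shows "\<exists>A. \<forall>u. (\<forall>y\<in>pverts G. u z \<le> u y) \<longrightarrow>
      (\<forall>y\<in>pverts G. graph_laplacian G \<omega> m u y \<le> h (u y - u z)) \<longrightarrow> u x - u z \<le> A"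
  using assms(2)
proof (induction rule: reachable_induct)
  case base
  then show ?case by (auto intro: exI[of _ 0])
next
  case (step x y)
  then obtain A where A: "\<And>u. (\<forall>y\<in>pverts G. u z \<le> u y) \<Longrightarrow>
      (\<forall>y\<in>pverts G. graph_laplacian G \<omega> m u y \<le> h (u y - u z)) \<Longrightarrow> u x - u z \<le> A"
    by blast
  have xy: "(x, y) \<in> parcs G" using step by simp
  then have V: "x \<in> pverts G" "y \<in> pverts G" by (auto dest: in_arcsD1 in_arcsD2)
  have w: "0 < \<omega> x y" using xy V edge_weight_pos_iff by blast
  define d where "d = (\<Sum>w\<in>nbrs x. \<omega> x w)"
  have d: "0 \<le> d" unfolding d_def using edge_weight_nonneg V by (intro sum_nonneg) auto
  \<comment> \<open>The new bound involves only \<open>A\<close>, \<open>h\<close> and graph data,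
    hence is uniform in \<open>u\<close>.\<close>
  have "u y - u z \<le> (m x * h A + d * A) / \<omega> x y"
    if u: "\<forall>y\<in>pverts G. u z \<le> u y"
      and L: "\<forall>y\<in>pverts G. graph_laplacian G \<omega> m u y \<le> h (u y - u z)" for u
  proof -
    \<comment> \<open>Since \<open>u z\<close> is the minimum, all summands are nonnegative and one
      of them is bounded by the whole sum.\<close>
    have "\<omega> x y * (u y - u z) \<le> (\<Sum>w\<in>nbrs x. \<omega> x w * (u w - u z))"
      using V xy u edge_weight_nonneg pair_finite_verts
      by (intro member_le_sum[where f = "\<lambda>w. \<omega> x w * (u w - u z)"]) auto
    also have "\<dots> = (\<Sum>w\<in>nbrs x. \<omega> x w * (u w - u x)) + d * (u x - u z)"
      unfolding d_def sum_distrib_right by (simp add: algebra_simps flip: sum.distrib)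
    also have "\<dots> = m x * graph_laplacian G \<omega> m u x + d * (u x - u z)"
      using V by (simp add: laplacian_mult_weight)
    also have "\<dots> \<le> m x * h A + d * A"
    proof (intro add_mono mult_left_mono)
      have "graph_laplacian G \<omega> m u x \<le> h (u x - u z)" using L V by blast
      also have "\<dots> \<le> h A" using A[OF u L] \<open>mono h\<close> by (rule monoD[rotated])
      finally show "graph_laplacian G \<omega> m u x \<le> h A" .
    qed (use A[OF u L] d V vertex_weight_pos[of x] in auto)
    finally show ?thesis using w by (simp add: pos_le_divide_eq mult.commute)
  qed
  then show ?case by blast
qed

text \<open>Every pair of vertices has a path bound; as there are finitely many pairs, the sum of
  their absolute values serves all of them.\<close>

lemma oscillation_bound:
  assumes "mono h"
  obtains A where "0 \<le> A"
    and "\<And>u z x. z \<in> pverts G \<Longrightarrow> x \<in> pverts G \<Longrightarrow> \<forall>y\<in>pverts G. u z \<le> u y \<Longrightarrow>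
      \<forall>y\<in>pverts G. graph_laplacian G \<omega> m u y \<le> h (u y - u z) \<Longrightarrow> u x \<le> u z + A"
proof -
  have "strongly_connected (with_proj G)"
    using symmetric_connected_imp_strongly_connected graph_connected sym_arcs by blast
  then have "\<forall>p\<in>pverts G \<times> pverts G. \<exists>A. \<forall>u. (\<forall>y\<in>pverts G. u (fst p) \<le> u y) \<longrightarrow>
      (\<forall>y\<in>pverts G. graph_laplacian G \<omega> m u y \<le> h (u y - u (fst p))) \<longrightarrow>
      u (snd p) - u (fst p) \<le> A"
    using bound_along_path[OF assms] by (auto simp: strongly_connected_def)
  then obtain g where g: "\<And>p u. p \<in> pverts G \<times> pverts G \<Longrightarrow> \<forall>y\<in>pverts G. u (fst p) \<le> u y \<Longrightarrow>
      \<forall>y\<in>pverts G. graph_laplacian G \<omega> m u y \<le> h (u y - u (fst p)) \<Longrightarrow>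
      u (snd p) - u (fst p) \<le> g p"
    by (metis (no_types, lifting))
  show thesis
  proof (rule that[of "\<Sum>p\<in>pverts G \<times> pverts G. \<bar>g p\<bar>"])
    show "0 \<le> (\<Sum>p\<in>pverts G \<times> pverts G. \<bar>g p\<bar>)" by (simp add: sum_nonneg)
    fix u z x assume *: "z \<in> pverts G" "x \<in> pverts G" "\<forall>y\<in>pverts G. u z \<le> u y"
      "\<forall>y\<in>pverts G. graph_laplacian G \<omega> m u y \<le> h (u y - u z)"
    have "u x - u z \<le> \<bar>g (z, x)\<bar>" using g[of "(z, x)" u] * by auto
    also have "\<dots> \<le> (\<Sum>p\<in>pverts G \<times> pverts G. \<bar>g p\<bar>)"
      using * pair_finite_verts by (intro member_le_sum) auto
    finally show "u x \<le> u z + (\<Sum>p\<in>pverts G \<times> pverts G. \<bar>g p\<bar>)" by linarith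
  qed
qed

text \<open>Rescaling \<open>u\<close> by \<open>inverse b\<close> reduces to the Laplacian bound 1.
  The linear dependence on \<open>b\<close> later turns a Laplacian of order \<open>exp M\<close>
  into an oscillation of order \<open>exp M\<close>.\<close>

lemma oscillation_le_laplacian_bound:
  obtains A where "0 \<le> A"
    and "\<And>u b x y. 0 < b \<Longrightarrow> \<forall>y\<in>pverts G. graph_laplacian G \<omega> m u y \<le> b \<Longrightarrow>
      x \<in> pverts G \<Longrightarrow> y \<in> pverts G \<Longrightarrow> u x \<le> u y + A * b"
proof -
  obtain A where A: "0 \<le> A"
    "\<And>u z x. z \<in> pverts G \<Longrightarrow> x \<in> pverts G \<Longrightarrow> \<forall>y\<in>pverts G. u z \<le> u y \<Longrightarrow>
      \<forall>y\<in>pverts G. graph_laplacian G \<omega> m u y \<le> 1 \<Longrightarrow> u x \<le> u z + A"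
    by (rule oscillation_bound[of "\<lambda>_. 1"]) (auto simp: mono_def)
  have "u x \<le> u y + A * b" if b: "0 < b" and L: "\<forall>y\<in>pverts G. graph_laplacian G \<omega> m u y \<le> b"
    and xy: "x \<in> pverts G" "y \<in> pverts G" for u b x y
  proof -
    obtain z where z: "z \<in> pverts G" "\<forall>y\<in>pverts G. u z \<le> u y"
      using ex_is_arg_min_if_finite[OF pair_finite_verts verts_nonempty, of u]
      by (auto simp: is_arg_min_linorder)
    have "inverse b * u x \<le> inverse b * u z + A"
    proof (rule A(2)[where u = "\<lambda>x. inverse b * u x", OF z(1) xy(1)])
      show "\<forall>y\<in>pverts G. inverse b * u z \<le> inverse b * u y" using z b by simp
      show "\<forall>y\<in>pverts G. graph_laplacian G \<omega> m (\<lambda>x. inverse b * u x) y \<le> 1"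
        unfolding laplacian_cmult using L b by (auto simp: field_simps)
    qed
    then have "u x \<le> u z + A * b" using b by (simp add: field_simps)
    then show ?thesis using z xy by force
  qed
  then show thesis using that A(1) by blast
qed

section \<open>A priori bounds for solutions\<close>

lemma sum_exp_poly_eq_0:
  assumes "\<forall>x\<in>pverts G. - graph_laplacian G \<omega> m u x = exp_poly n f c x (u x)"
  shows "(\<Sum>x\<in>pverts G. m x * exp_poly n f c x (u x)) = 0"
proof -
  have "(\<Sum>x\<in>pverts G. m x * exp_poly n f c x (u x))
      = - (\<Sum>x\<in>pverts G. m x * graph_laplacian G \<omega> m u x)"
    using assms by (simp flip: sum_negf) (metis (no_types, lifting) mult_minus_right sum.cong)
  then show ?thesis by (simp add: sum_laplacian_eq_0)
qed

text \<open>With \<open>E = exp (u p)\<close> and \<open>u p \<le> 0\<close>, either nondegeneracy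
  alternative forces \<open>1 / K \<le> Q * E\<close>, because the nonlinearity has vanishing
  average.\<close>

lemma max_lower_bound:
  assumes n: "1 \<le> n" and K: "0 < K"
  obtains B where "\<And>f c u p.
    \<lbrakk>\<forall>x\<in>pverts G. - graph_laplacian G \<omega> m u x = exp_poly n f c x (u x);
     \<forall>x\<in>pverts G. (\<Sum>i=1..n. \<bar>f i x\<bar>) + \<bar>c\<bar> \<le> K;
     1 / K \<le> \<bar>c\<bar> \<or> c = 0 \<and> 1 / K \<le> \<bar>graph_average G m (f 1)\<bar>;
     p \<in> pverts G; \<forall>x\<in>pverts G. u x \<le> u p\<rbrakk> \<Longrightarrow> B \<le> u p"
proof -
  obtain A where A: "0 \<le> A"
    "\<And>u b x y. 0 < b \<Longrightarrow> \<forall>y\<in>pverts G. graph_laplacian G \<omega> m u y \<le> b \<Longrightarrow>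
      x \<in> pverts G \<Longrightarrow> y \<in> pverts G \<Longrightarrow> u x \<le> u y + A * b"
    using oscillation_le_laplacian_bound by blast
  \<comment> \<open>One \<open>K\<close> comes from the terms of index at least 2, and
    \<open>K * (K * A)\<close> from replacing \<open>exp (u x)\<close> by \<open>E\<close>. Since
    \<open>Q \<ge> K\<close>, the same constant covers the case of large \<open>c\<close>.\<close>
  define Q where "Q = K * (1 + K * A)"
  have KQ: "K \<le> Q" using K A(1) by (simp add: Q_def)
  show thesis
  \<comment> \<open>The \<open>min 0\<close> disposes of a positive maximum, so only
    \<open>u p \<le> 0\<close> needs the estimates.\<close>
  proof (rule that[of "min 0 (ln (1 / (K * Q)))"])
    fix f :: "nat \<Rightarrow> 'v \<Rightarrow> real" and c u p
    assume eq: "\<forall>x\<in>pverts G. - graph_laplacian G \<omega> m u x = exp_poly n f c x (u x)"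
      and bd: "\<forall>x\<in>pverts G. (\<Sum>i=1..n. \<bar>f i x\<bar>) + \<bar>c\<bar> \<le> K"
      and nd: "1 / K \<le> \<bar>c\<bar> \<or> c = 0 \<and> 1 / K \<le> \<bar>graph_average G m (f 1)\<bar>"
      and p: "p \<in> pverts G" and max: "\<forall>x\<in>pverts G. u x \<le> u p"
    define E where "E = exp (u p)"
    have E: "0 < E" by (simp add: E_def)
    note s0 = sum_exp_poly_eq_0[OF eq]
    have "1 / (K * Q) \<le> E" if M: "u p \<le> 0"
    proof -
      have close: "\<bar>exp_poly n f c x (u x) - c\<bar> \<le> K * E" if "x \<in> pverts G" for x
        unfolding E_def using max bd that M by (intro exp_poly_minus_const_le) auto
      from nd have "1 / K \<le> Q * E"
      proof
        assume "1 / K \<le> \<bar>c\<bar>"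
        also have "c = graph_average G m (\<lambda>_. c)"
          using weight_sum_pos by (simp add: graph_average_def flip: sum_distrib_right)
        also have "\<bar>\<dots>\<bar> \<le> K * E" using s0 close by (rule abs_average_le_of_close)
        also have "\<dots> \<le> Q * E" using KQ E by (intro mult_right_mono) auto
        finally show ?thesis .
      next
        assume c: "c = 0 \<and> 1 / K \<le> \<bar>graph_average G m (f 1)\<bar>"
        \<comment> \<open>With \<open>c = 0\<close> the nonlinearity itself, and hence the
          Laplacian, is bounded by \<open>K * E\<close>.\<close>
        have osc: "u p \<le> u x + A * (K * E)" if "x \<in> pverts G" for x
        proof (rule A(2)[OF _ _ p that])
          show "0 < K * E" using K E by simp
          show "\<forall>y\<in>pverts G. graph_laplacian G \<omega> m u y \<le> K * E"
          proof
            fix y assume y: "y \<in> pverts G"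
            show "graph_laplacian G \<omega> m u y \<le> K * E"
              using close[OF y] bspec[OF eq y] c by linarith
          qed
        qed
        have "\<bar>exp_poly n f c x (u x) - f 1 x * E\<bar> \<le> Q * E * E" if x: "x \<in> pverts G" for x
        proof -
          have bx: "(\<Sum>i=1..n. \<bar>f i x\<bar>) \<le> K" using bd x c by auto
          have "\<bar>f 1 x\<bar> \<le> (\<Sum>i=1..n. \<bar>f i x\<bar>)"
            using n by (intro member_le_sum) auto
          then have f1: "\<bar>f 1 x\<bar> \<le> K" using bx by linarith
          have "exp (u x) \<le> E" using max x by (simp add: E_def)
          \<comment> \<open>Convexity of the exponential turns the oscillation bound into a bound of
            order \<open>E * E\<close> on \<open>exp (u x) - E\<close>.\<close>
          have "1 + (u x - u p) \<le> exp (u x - u p)" by (rule exp_ge_add_one_self)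
          then have "1 - exp (u x - u p) \<le> A * (K * E)" using osc[OF x] by linarith
          then have "E * (1 - exp (u x - u p)) \<le> E * (A * (K * E))"
            using E by (intro mult_left_mono) auto
          moreover have "E * exp (u x - u p) = exp (u x)" by (simp add: E_def flip: exp_add)
          ultimately have "\<bar>exp (u x) - E\<bar> \<le> A * K * E * E"
            using \<open>exp (u x) \<le> E\<close> by (simp add: algebra_simps)
          then have "\<bar>f 1 x\<bar> * \<bar>exp (u x) - E\<bar> \<le> K * (A * K * E * E)"
            using f1 K by (intro mult_mono) auto
          then have 1: "\<bar>f 1 x * exp (u x) - f 1 x * E\<bar> \<le> K * (A * K * E * E)"
            by (simp flip: abs_mult right_diff_distrib)
          have "\<bar>exp_poly n f 0 x (u x) - f 1 x * exp (u x)\<bar> \<le> K * E\<^sup>2"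
            unfolding E_def using max x M bx n by (intro exp_poly_minus_linear_le) auto
          then have "\<bar>exp_poly n f c x (u x) - f 1 x * exp (u x)\<bar> \<le> K * E\<^sup>2"
            using c by simp
          with 1 have "\<bar>exp_poly n f c x (u x) - f 1 x * E\<bar> \<le> K * (A * K * E * E) + K * E\<^sup>2"
            by linarith
          also have "\<dots> = Q * E * E" by (simp add: Q_def power2_eq_square algebra_simps)
          finally show ?thesis .
        qed
        then have "\<bar>graph_average G m (\<lambda>x. f 1 x * E)\<bar> \<le> Q * E * E"
          by (rule abs_average_le_of_close[OF s0])
        moreover have "graph_average G m (\<lambda>x. f 1 x * E) = graph_average G m (f 1) * E"
          by (simp add: graph_average_def sum_distrib_right mult.assoc)
        ultimately have "\<bar>graph_average G m (f 1)\<bar> * E \<le> (Q * E) * E"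
          using E by (simp add: abs_mult)
        then have "\<bar>graph_average G m (f 1)\<bar> \<le> Q * E" using E by simp
        then show ?thesis using c by linarith
      qed
      then show ?thesis using K KQ by (simp add: field_simps)
    qed
    moreover have "0 < 1 / (K * Q)" using K KQ by simp
    ultimately show "min 0 (ln (1 / (K * Q))) \<le> u p"
      unfolding E_def using ln_le_cancel_iff[of "1 / (K * Q)" "exp (u p)"] by fastforce
  qed
qed

lemma minimum_bound:
  assumes K: "0 < K"
  obtains B where "0 \<le> B" and "\<And>f c u x\<^sub>0.
    \<lbrakk>\<forall>x\<in>pverts G. - graph_laplacian G \<omega> m u x = exp_poly n f c x (u x);
     \<forall>x\<in>pverts G. (\<Sum>i=1..n. \<bar>f i x\<bar>) + \<bar>c\<bar> \<le> K;
     x\<^sub>0 \<in> pverts G;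
     exp_lead_coeff n f x\<^sub>0 \<ge> 1 / K \<or>
       (exp_lead_coeff n f x\<^sub>0 \<le> - (1 / K) \<and>
        (\<forall>x\<in>pverts G. (\<forall>i\<in>{1..n}. f i x \<le> 0) \<or> exp_lead_coeff n f x \<le> - (1 / K)))\<rbrakk>
     \<Longrightarrow> \<exists>z\<in>pverts G. u z \<le> B"
proof -
  \<comment> \<open>The weighted degree \<open>d x\<close> bounds
    \<open>- graph_laplacian G \<omega> m u x\<close> by \<open>d x * u x\<close> when
    \<open>u\<close> is nonnegative; \<open>R\<close> dominates all degrees.\<close>
  define d where "d x = (\<Sum>y\<in>nbrs x. \<omega> x y) / m x" for x
  define R where "R = (\<Sum>x\<in>pverts G. d x)"
  define W where "W = (\<Sum>x\<in>pverts G. m x)"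
  \<comment> \<open>Chosen so that \<open>K * W \<le> m x * S\<close> at every vertex: a value below
    \<open>- S\<close> at one vertex outweighs values up to \<open>K\<close> at all others.\<close>
  define S where "S = K * W * (\<Sum>x\<in>pverts G. 1 / m x)"
  have d: "0 \<le> d x" if "x \<in> pverts G" for x
    unfolding d_def using that edge_weight_nonneg vertex_weight_pos[of x]
    by (intro divide_nonneg_pos sum_nonneg) auto
  have W: "0 < W" using weight_sum_pos by (simp add: W_def)
  have dR: "d x \<le> R" if "x \<in> pverts G" for x
    unfolding R_def using that d pair_finite_verts by (intro member_le_sum) auto
  have R: "0 \<le> R" unfolding R_def using d by (rule sum_nonneg)
  have inv: "0 < 1 / m x" if "x \<in> pverts G" for x using that vertex_weight_pos by simp
  have mS: "K * W \<le> m x * S" if x: "x \<in> pverts G" for x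
  proof -
    have "1 / m x \<le> (\<Sum>x\<in>pverts G. 1 / m x)"
      using x inv pair_finite_verts less_imp_le by (intro member_le_sum) auto
    then have "1 \<le> m x * (\<Sum>x\<in>pverts G. 1 / m x)"
      using vertex_weight_pos[OF x] by (simp add: field_simps)
    then have "K * W * 1 \<le> K * W * (m x * (\<Sum>x\<in>pverts G. 1 / m x))"
      using K W by (intro mult_left_mono) auto
    then show ?thesis by (simp add: S_def mult_ac)
  qed
  have S: "0 \<le> S" unfolding S_def using K W inv by (intro mult_nonneg_nonneg sum_nonneg) (auto simp: less_imp_le)
  \<comment> \<open>Divided by \<open>K\<close>, this says \<open>R * t + S < exp t / K - K\<close>
    for \<open>t \<ge> B\<close>, which serves both sign conditions.\<close>
  obtain B where B: "0 \<le> B" "\<And>t. B \<le> t \<Longrightarrow> (K * R) * t + K * (K + S) < exp t"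
    using exp_dominates_linear[of "K * R" "K * (K + S)"] K R S by auto
  show thesis
  proof (rule that[OF B(1)], rule ccontr)
    fix f :: "nat \<Rightarrow> 'v \<Rightarrow> real" and c u x\<^sub>0
    assume eq: "\<forall>x\<in>pverts G. - graph_laplacian G \<omega> m u x = exp_poly n f c x (u x)"
      and bd: "\<forall>x\<in>pverts G. (\<Sum>i=1..n. \<bar>f i x\<bar>) + \<bar>c\<bar> \<le> K"
      and x0: "x\<^sub>0 \<in> pverts G"
      and lead: "exp_lead_coeff n f x\<^sub>0 \<ge> 1 / K \<or>
       (exp_lead_coeff n f x\<^sub>0 \<le> - (1 / K) \<and>
        (\<forall>x\<in>pverts G. (\<forall>i\<in>{1..n}. f i x \<le> 0) \<or> exp_lead_coeff n f x \<le> - (1 / K)))"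
      and "\<not> (\<exists>z\<in>pverts G. u z \<le> B)"
    then have uB: "B < u x" if "x \<in> pverts G" for x using that by force
    then have u0: "0 \<le> u x" if "x \<in> pverts G" for x using that B(1) by force
    have big: "R * u x + S < exp (u x) / K - K" if "x \<in> pverts G" for x
      using B(2)[of "u x"] uB[OF that] K by (simp add: field_simps)
    have Ru: "0 \<le> R * u x" if "x \<in> pverts G" for x using that R u0 by simp
    have KK: "K * K \<le> exp (u x)" if "x \<in> pverts G" for x
    proof -
      have "0 < exp (u x) / K - K" using big[OF that] Ru[OF that] S by linarith
      then show ?thesis using K by (simp add: field_simps)
    qed
    from lead show False
    proof
      assume "exp_lead_coeff n f x\<^sub>0 \<ge> 1 / K"
      then have "exp (u x\<^sub>0) / K - K \<le> exp_poly n f c x\<^sub>0 (u x\<^sub>0)"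
        using x0 bd u0 KK K by (intro exp_poly_ge_of_lead_coeff) auto
      also have "\<dots> = - graph_laplacian G \<omega> m u x\<^sub>0" using eq x0 by simp
      also have "\<dots> = (\<Sum>y\<in>nbrs x\<^sub>0. \<omega> x\<^sub>0 y * (u x\<^sub>0 - u y)) / m x\<^sub>0"
        by (simp add: graph_laplacian_def right_diff_distrib sum_subtractf diff_divide_distrib)
      also have "\<dots> \<le> (\<Sum>y\<in>nbrs x\<^sub>0. \<omega> x\<^sub>0 y * u x\<^sub>0) / m x\<^sub>0"
        using x0 u0 edge_weight_nonneg vertex_weight_pos[OF x0]
        by (intro divide_right_mono sum_mono mult_left_mono) auto
      also have "\<dots> = d x\<^sub>0 * u x\<^sub>0" by (simp add: d_def sum_distrib_right)
      also have "\<dots> \<le> R * u x\<^sub>0" using dR u0 x0 by (intro mult_right_mono) auto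
      finally show False using big[OF x0] S by linarith
    next
      assume neg: "exp_lead_coeff n f x\<^sub>0 \<le> - (1 / K) \<and>
        (\<forall>x\<in>pverts G. (\<forall>i\<in>{1..n}. f i x \<le> 0) \<or> exp_lead_coeff n f x \<le> - (1 / K))"
      define F where "F x = exp_poly n f c x (u x)" for x
      have lead_neg: "F x < - S" if "x \<in> pverts G" "exp_lead_coeff n f x \<le> - (1 / K)" for x
      proof -
        have "F x \<le> K - exp (u x) / K"
          unfolding F_def using that bd u0 KK K by (intro exp_poly_le_of_lead_coeff) auto
        then show ?thesis using big[OF that(1)] Ru[OF that(1)] by linarith
      qed
      \<comment> \<open>If all coefficients are nonpositive then \<open>F x \<le> c\<close>;
        otherwise the leading coefficient is negative and \<open>F x < - S\<close>.\<close>
      have FK: "F x \<le> K" if x: "x \<in> pverts G" for x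
      proof (cases "\<forall>i\<in>{1..n}. f i x \<le> 0")
        case True
        then have "(\<Sum>i=1..n. f i x * exp (real i * u x)) \<le> 0"
          by (intro sum_nonpos) (auto simp: mult_nonpos_nonneg)
        moreover have "0 \<le> (\<Sum>i=1..n. \<bar>f i x\<bar>)" by (simp add: sum_nonneg)
        ultimately show ?thesis using bspec[OF bd x] unfolding F_def exp_poly_def by linarith
      next
        case False
        then show ?thesis using neg lead_neg[OF x] x S K by force
      qed
      have "(\<Sum>x\<in>pverts G. m x * F x) = m x\<^sub>0 * F x\<^sub>0 + (\<Sum>x\<in>pverts G - {x\<^sub>0}. m x * F x)"
        using x0 pair_finite_verts by (simp add: sum.remove)
      moreover have "m x\<^sub>0 * F x\<^sub>0 < m x\<^sub>0 * (- S)"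
        using neg lead_neg x0 vertex_weight_pos by (intro mult_strict_left_mono) auto
      moreover have "(\<Sum>x\<in>pverts G - {x\<^sub>0}. m x * F x) \<le> K * W"
      proof -
        have "(\<Sum>x\<in>pverts G - {x\<^sub>0}. m x * F x) \<le> (\<Sum>x\<in>pverts G - {x\<^sub>0}. m x * K)"
          using FK vertex_weight_pos by (intro sum_mono mult_left_mono) (auto simp: less_imp_le)
        also have "\<dots> \<le> (\<Sum>x\<in>pverts G. m x * K)"
          using pair_finite_verts vertex_weight_pos K by (intro sum_mono2) (auto simp: less_imp_le)
        finally show ?thesis by (simp add: W_def sum_distrib_left mult.commute)
      qed
      ultimately have "(\<Sum>x\<in>pverts G. m x * F x) < 0" using mS[OF x0] by simp
      then show False using sum_exp_poly_eq_0[OF eq] by (simp add: F_def)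
    qed
  qed
qed

text \<open>With the minimum at most \<open>B\<close>, the Laplacian is bounded by an increasing
  function of the excess over the minimum, so \<open>oscillation_bound\<close> applies.\<close>

lemma oscillation_and_upper_bound:
  assumes K: "0 < K"
  obtains A B where "\<And>f c u x\<^sub>0 x y.
    \<lbrakk>\<forall>x\<in>pverts G. - graph_laplacian G \<omega> m u x = exp_poly n f c x (u x);
     \<forall>x\<in>pverts G. (\<Sum>i=1..n. \<bar>f i x\<bar>) + \<bar>c\<bar> \<le> K;
     x\<^sub>0 \<in> pverts G;
     exp_lead_coeff n f x\<^sub>0 \<ge> 1 / K \<or>
       (exp_lead_coeff n f x\<^sub>0 \<le> - (1 / K) \<and>
        (\<forall>x\<in>pverts G. (\<forall>i\<in>{1..n}. f i x \<le> 0) \<or> exp_lead_coeff n f x \<le> - (1 / K)));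
     x \<in> pverts G; y \<in> pverts G\<rbrakk>
     \<Longrightarrow> u x \<le> u y + A \<and> u x \<le> B"
proof -
  obtain B where B: "0 \<le> B" "\<And>f c u x\<^sub>0.
    \<lbrakk>\<forall>x\<in>pverts G. - graph_laplacian G \<omega> m u x = exp_poly n f c x (u x);
     \<forall>x\<in>pverts G. (\<Sum>i=1..n. \<bar>f i x\<bar>) + \<bar>c\<bar> \<le> K;
     x\<^sub>0 \<in> pverts G;
     exp_lead_coeff n f x\<^sub>0 \<ge> 1 / K \<or>
       (exp_lead_coeff n f x\<^sub>0 \<le> - (1 / K) \<and>
        (\<forall>x\<in>pverts G. (\<forall>i\<in>{1..n}. f i x \<le> 0) \<or> exp_lead_coeff n f x \<le> - (1 / K)))\<rbrakk>
     \<Longrightarrow> \<exists>z\<in>pverts G. u z \<le> B"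
    by (rule minimum_bound[OF K, of n]) (erule that)
  \<comment> \<open>At excess \<open>t\<close> the value of \<open>u\<close> is at most
    \<open>B + t\<close>; this is nonnegative, so the index \<open>n\<close> gives the largest
    exponent.\<close>
  define h where "h t = K * exp (real n * (B + t))" for t
  have "mono h" using K by (auto simp: mono_def h_def intro!: mult_left_mono)
  then obtain A where A: "0 \<le> A"
    "\<And>u z x. z \<in> pverts G \<Longrightarrow> x \<in> pverts G \<Longrightarrow> \<forall>y\<in>pverts G. u z \<le> u y \<Longrightarrow>
      \<forall>y\<in>pverts G. graph_laplacian G \<omega> m u y \<le> h (u y - u z) \<Longrightarrow> u x \<le> u z + A"
    using oscillation_bound by blast
  show thesis
  proof (rule that[of A "B + A"])
    fix f :: "nat \<Rightarrow> 'v \<Rightarrow> real" and c u x\<^sub>0 x y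
    assume eq: "\<forall>x\<in>pverts G. - graph_laplacian G \<omega> m u x = exp_poly n f c x (u x)"
      and bd: "\<forall>x\<in>pverts G. (\<Sum>i=1..n. \<bar>f i x\<bar>) + \<bar>c\<bar> \<le> K"
      and x0: "x\<^sub>0 \<in> pverts G"
      and lead: "exp_lead_coeff n f x\<^sub>0 \<ge> 1 / K \<or>
       (exp_lead_coeff n f x\<^sub>0 \<le> - (1 / K) \<and>
        (\<forall>x\<in>pverts G. (\<forall>i\<in>{1..n}. f i x \<le> 0) \<or> exp_lead_coeff n f x \<le> - (1 / K)))"
      and xy: "x \<in> pverts G" "y \<in> pverts G"
    obtain z where z: "z \<in> pverts G" "\<forall>y\<in>pverts G. u z \<le> u y"
      using ex_is_arg_min_if_finite[OF pair_finite_verts verts_nonempty, of u]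
      by (auto simp: is_arg_min_linorder)
    have uz: "u z \<le> B" using B(2)[OF eq bd x0 lead] z by force
    have "u x \<le> u z + A"
    proof (rule A(2)[OF z(1) xy(1) z(2)], rule ballI)
      fix y assume y: "y \<in> pverts G"
      have t: "0 \<le> u y - u z" using z y by simp
      have "\<bar>exp_poly n f c y (u y)\<bar> \<le> K * exp (real n * (B + (u y - u z)))"
      proof (rule abs_exp_poly_le)
        fix i assume "1 \<le> i" "i \<le> n"
        then have "real i * u y \<le> real i * (B + (u y - u z))"
          using uz by (intro mult_left_mono) auto
        also have "\<dots> \<le> real n * (B + (u y - u z))"
          using \<open>i \<le> n\<close> B(1) t by (intro mult_right_mono) auto
        finally show "exp (real i * u y) \<le> exp (real n * (B + (u y - u z)))" by simp
      qed (use bd y B(1) t in auto)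
      then show "graph_laplacian G \<omega> m u y \<le> h (u y - u z)"
        using bspec[OF eq y] unfolding h_def by linarith
    qed
    then show "u x \<le> u y + A \<and> u x \<le> B + A" using z xy uz by force
  qed
qed

end

section \<open>Combination into a two-sided bound\<close>

theorem theorem1p2:
  fixes G :: "'v pair_pre_digraph"
    and \<omega> :: "'v \<Rightarrow> 'v \<Rightarrow> real"
    and m :: "'v \<Rightarrow> real"
    and n :: nat
    and K :: real
  assumes "weighted_graph G \<omega> m"
    and "n \<ge> 1"
    and "K > 0"
  shows "\<exists>C :: real. \<forall>(f :: nat \<Rightarrow> 'v \<Rightarrow> real) (c :: real) (u :: 'v \<Rightarrow> real).
    (\<forall>x\<in>pverts G. - graph_laplacian G \<omega> m u x = exp_poly n f c x (u x)) \<longrightarrow>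
    (\<Sum>i=1..n. Max ((\<lambda>x. \<bar>f i x\<bar>) ` pverts G)) + \<bar>c\<bar> \<le> K \<longrightarrow>
    (\<bar>c\<bar> \<ge> 1 / K \<or> (c = 0 \<and> \<bar>graph_average G m (f 1)\<bar> \<ge> 1 / K)) \<longrightarrow>
    (\<exists>x\<^sub>0\<in>pverts G.
       exp_lead_coeff n f x\<^sub>0 \<ge> 1 / K \<or>
       (exp_lead_coeff n f x\<^sub>0 \<le> - (1 / K) \<and>
        (\<forall>x\<in>pverts G. (\<forall>i\<in>{1..n}. f i x \<le> 0) \<or> exp_lead_coeff n f x \<le> - (1 / K)))) \<longrightarrow>
    Max ((\<lambda>x. \<bar>u x\<bar>) ` pverts G) \<le> C"
proof -
  interpret weighted_graph G \<omega> m by fact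
  obtain L where L: "\<And>f c u p.
    \<lbrakk>\<forall>x\<in>pverts G. - graph_laplacian G \<omega> m u x = exp_poly n f c x (u x);
     \<forall>x\<in>pverts G. (\<Sum>i=1..n. \<bar>f i x\<bar>) + \<bar>c\<bar> \<le> K;
     1 / K \<le> \<bar>c\<bar> \<or> c = 0 \<and> 1 / K \<le> \<bar>graph_average G m (f 1)\<bar>;
     p \<in> pverts G; \<forall>x\<in>pverts G. u x \<le> u p\<rbrakk> \<Longrightarrow> L \<le> u p"
    by (rule max_lower_bound[OF assms(2,3)]) (erule that)
  obtain A B where U: "\<And>f c u x\<^sub>0 x y.
    \<lbrakk>\<forall>x\<in>pverts G. - graph_laplacian G \<omega> m u x = exp_poly n f c x (u x);
     \<forall>x\<in>pverts G. (\<Sum>i=1..n. \<bar>f i x\<bar>) + \<bar>c\<bar> \<le> K;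
     x\<^sub>0 \<in> pverts G;
     exp_lead_coeff n f x\<^sub>0 \<ge> 1 / K \<or>
       (exp_lead_coeff n f x\<^sub>0 \<le> - (1 / K) \<and>
        (\<forall>x\<in>pverts G. (\<forall>i\<in>{1..n}. f i x \<le> 0) \<or> exp_lead_coeff n f x \<le> - (1 / K)));
     x \<in> pverts G; y \<in> pverts G\<rbrakk>
     \<Longrightarrow> u x \<le> u y + A \<and> u x \<le> B"
    by (rule oscillation_and_upper_bound[OF assms(3), of n]) (erule that)
  show ?thesis
  \<comment> \<open>Every value is at most \<open>B\<close>, and at least \<open>L - A\<close>
    because the maximum is at least \<open>L\<close> and the oscillation at most \<open>A\<close>.
    The absolute values are taken since the signs are unknown.\<close>
  proof (intro exI[of _ "\<bar>B\<bar> + \<bar>L - A\<bar>"] allI impI)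
    fix f :: "nat \<Rightarrow> 'v \<Rightarrow> real" and c u
    assume eq: "\<forall>x\<in>pverts G. - graph_laplacian G \<omega> m u x = exp_poly n f c x (u x)"
      and K: "(\<Sum>i=1..n. Max ((\<lambda>x. \<bar>f i x\<bar>) ` pverts G)) + \<bar>c\<bar> \<le> K"
      and nd: "\<bar>c\<bar> \<ge> 1 / K \<or> (c = 0 \<and> \<bar>graph_average G m (f 1)\<bar> \<ge> 1 / K)"
      and "\<exists>x\<^sub>0\<in>pverts G.
       exp_lead_coeff n f x\<^sub>0 \<ge> 1 / K \<or>
       (exp_lead_coeff n f x\<^sub>0 \<le> - (1 / K) \<and>
        (\<forall>x\<in>pverts G. (\<forall>i\<in>{1..n}. f i x \<le> 0) \<or> exp_lead_coeff n f x \<le> - (1 / K)))"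
    then obtain x\<^sub>0 where x0: "x\<^sub>0 \<in> pverts G" and lead: "exp_lead_coeff n f x\<^sub>0 \<ge> 1 / K \<or>
       (exp_lead_coeff n f x\<^sub>0 \<le> - (1 / K) \<and>
        (\<forall>x\<in>pverts G. (\<forall>i\<in>{1..n}. f i x \<le> 0) \<or> exp_lead_coeff n f x \<le> - (1 / K)))"
      by blast
    have bd: "\<forall>x\<in>pverts G. (\<Sum>i=1..n. \<bar>f i x\<bar>) + \<bar>c\<bar> \<le> K"
      using sum_bound_of_Max_bound[OF pair_finite_verts _ K] by blast
    obtain p where p: "p \<in> pverts G" "\<forall>x\<in>pverts G. u x \<le> u p"
      using ex_is_arg_min_if_finite[OF pair_finite_verts verts_nonempty, of "\<lambda>x. - u x"]
      by (auto simp: is_arg_min_linorder)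
    have "\<bar>u x\<bar> \<le> \<bar>B\<bar> + \<bar>L - A\<bar>" if "x \<in> pverts G" for x
      using U[OF eq bd x0 lead that p(1)] U[OF eq bd x0 lead p(1) that] L[OF eq bd nd p] by linarith
    then show "Max ((\<lambda>x. \<bar>u x\<bar>) ` pverts G) \<le> \<bar>B\<bar> + \<bar>L - A\<bar>"
      using pair_finite_verts verts_nonempty by simp
  qed
qed

end
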